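(* Let $k\ge 1$ and $n\geq 2$ be integers and let $\alpha$ be the unique positive real root of $\phi(x)=x^3-2kx^2-kx-1$. For every real $r>0$ with $r\neq\alpha^{-1}$ and $r\neq P_{k,n-1}^{-n/2}P_{k,n}^{n/2}$, the $r$-circulant matrix $$\mathbf{P}_n=\mathrm{Circ}_r(P_{k,0},P_{k,1},\ldots,P_{k,n-1})$$ is invertible.
   Context: For an integer $k\geq 1$, the generalized $k$-Pell-Tribonacci sequence $(P_{k,n})_{n\ge 0}$ is defined by $P_{k,0}=0$, $P_{k,1}=1$, $P_{k,2}=2k$ and $P_{k,n}=2kP_{k,n-1}+kP_{k,n-2}+P_{k,n-3}$ for $n\geq 3$. Its characteristic polynomial $\phi(x)=x^3-2kx^2-kx-1$ has exactly one positive real root. For $n\ge 2$, $r\in\mathbb{C}$ and $a_0,\dots,a_{n-1}\in\mathbb{C}$, the $r$-circulant matrix $\mathrm{Circ}_r(a_0,\dots,a_{n-1})$ is the $n\times n$ matrix whose $(i,j)$ entry ($1\le i,j\le n$) is $a_{j-i}$ if $j\ge i$ and $r\,a_{n+j-i}$ if $j<i$. *)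

theory Defs
  imports
    "HOL-Analysis.Analysis"
    "HOL-Computational_Algebra.Polynomial"
    "Jordan_Normal_Form.Matrix"
begin

fun pell_tribonacci :: "nat \<Rightarrow> nat \<Rightarrow> nat" where
  "pell_tribonacci k 0 = 0"
| "pell_tribonacci k (Suc 0) = 1"
| "pell_tribonacci k (Suc (Suc 0)) = 2 * k"
| "pell_tribonacci k (Suc (Suc (Suc n))) =
     2 * k * pell_tribonacci k (Suc (Suc n)) + k * pell_tribonacci k (Suc n) + pell_tribonacci k n"

text \<open>Coefficients are listed in increasing degree: \<open>x^3 - 2kx^2 - kx - 1\<close>.\<close>

definition pell_tribonacci_char_poly :: "nat \<Rightarrow> real poly" where
  "pell_tribonacci_char_poly k = [:- 1, - real k, - 2 * real k, 1:]"

lemma poly_pell_tribonacci_char_poly: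
  "poly (pell_tribonacci_char_poly k) x = x ^ 3 - 2 * real k * x ^ 2 - real k * x - 1"
  by (simp add: pell_tribonacci_char_poly_def algebra_simps power2_eq_square power3_eq_cube)

lemma ex1_pos_root_pell_tribonacci_char_poly:
  "\<exists>!x. 0 < x \<and> poly (pell_tribonacci_char_poly k) x = 0"
proof (rule ex_ex1I)
  let ?p = "pell_tribonacci_char_poly k"
  let ?M = "3 * real k + 2"
  have "?M ^ 3 - 2 * real k * ?M ^ 2 - real k * ?M - 1
      = 9 * real k ^ 3 + 27 * real k ^ 2 + 26 * real k + 7"
    by (simp add: algebra_simps power2_eq_square power3_eq_cube)
  moreover have "0 < 9 * real k ^ 3 + 27 * real k ^ 2 + 26 * real k + 7"
    by (simp add: add_nonneg_pos)
  ultimately have "0 < poly ?p ?M"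
    unfolding poly_pell_tribonacci_char_poly by linarith
  moreover have "poly ?p 0 < 0"
    by (simp add: poly_pell_tribonacci_char_poly)
  ultimately show "\<exists>x. 0 < x \<and> poly ?p x = 0"
    using poly_IVT_pos[of 0 ?M ?p] by force
next
  let ?p = "pell_tribonacci_char_poly k"
  have no: False if "0 < x" "x < y" "poly ?p x = 0" "poly ?p y = 0" for x y :: real
  proof -
    have rx: "x ^ 3 = 2 * real k * x ^ 2 + real k * x + 1"
      and ry: "y ^ 3 = 2 * real k * y ^ 2 + real k * y + 1"
      using that(3,4) by (simp_all add: poly_pell_tribonacci_char_poly)
    have "x ^ 3 * y ^ 3 = (2 * real k * x ^ 2 + real k * x + 1) * y ^ 3"
      using rx by simp
    moreover have "x ^ 3 * y ^ 3 = (2 * real k * y ^ 2 + real k * y + 1) * x ^ 3"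
      using ry by (simp add: mult.commute)
    ultimately have eq: "2 * real k * (x ^ 2 * y ^ 2) * (y - x)
        + real k * (x * y) * (y ^ 2 - x ^ 2) + (y ^ 3 - x ^ 3) = 0"
      by (simp add: algebra_simps power2_eq_square power3_eq_cube)
    have "0 \<le> 2 * real k * (x ^ 2 * y ^ 2) * (y - x)"
      using that by simp
    moreover have "0 \<le> real k * (x * y) * (y ^ 2 - x ^ 2)"
      using that power_mono[of x y 2] by simp
    moreover have "0 < y ^ 3 - x ^ 3"
      using that power_strict_mono[of x y 3] by simp
    ultimately show False
      using eq by linarith
  qed
  show "x = y" if "0 < x \<and> poly ?p x = 0" "0 < y \<and> poly ?p y = 0" for x y
    using no[of x y] no[of y x] that by (cases x y rule: linorder_cases) auto
qed

text \<open>Rows and columns are indexed from 0. The entries \<open>a_0, \<dots>, a_{n-1}\<close> are given by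
  a function of which only the first \<open>n\<close> values are used.\<close>

definition r_circulant :: "nat \<Rightarrow> complex \<Rightarrow> (nat \<Rightarrow> complex) \<Rightarrow> complex mat" where
  "r_circulant n r a = mat n n (\<lambda>(i, j). if i \<le> j then a (j - i) else r * a (n + j - i))"

definition pell_tribonacci_circulant :: "nat \<Rightarrow> nat \<Rightarrow> complex \<Rightarrow> complex mat" where
  "pell_tribonacci_circulant k n r = r_circulant n r (\<lambda>i. of_nat (pell_tribonacci k i))"

end

theory Submission
  imports Defs "Jordan_Normal_Form.Determinant"
begin

text \<open>
  Pairing \<open>Circ\<^sub>r(a)\<close> with the vector \<open>(x\<^sup>i)\<close> shows that the matrix is invertible once
  \<open>f(x) = \<Sum>i<n. a\<^sub>i x\<^sup>i\<close> has no zero among the \<open>n\<close>-th roots \<open>x\<close> of \<open>r\<close>. For the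
  Pell-Tribonacci numbers, multiplying \<open>f\<close> by the denominator of their generating function turns
  \<open>f(x) = 0\<close> into a real quadratic equation for \<open>x\<close> whose roots have product
  \<open>P\<^sub>n / P\<^sub>n\<^sub>-\<^sub>1\<close>. A non-real solution \<open>x\<close> has \<open>|x|\<^sup>2 = P\<^sub>n / P\<^sub>n\<^sub>-\<^sub>1\<close>, which is the
  excluded value of \<open>r = |x|\<^sup>n\<close>. A positive \<open>x\<close> is impossible by positivity of the coefficients.
  For \<open>x = -t < 0\<close> the number \<open>n\<close> is even; if \<open>k \<le> 8\<close>, the sign of the quadratic polynomial
  excludes \<open>x\<close>. If \<open>k \<ge> 9\<close>, then \<open>P\<^sub>i\<^sub>+\<^sub>1 - \<alpha> P\<^sub>i\<close> alternates in sign, so the terms of \<open>f(-t)\<close>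
  can be grouped in pairs of constant sign, in one way for \<open>\<alpha> t \<le> 1\<close> and in the other for
  \<open>\<alpha> t \<ge> 1\<close>.
\<close>

section \<open>Invertibility of r-circulant matrices\<close>

lemma invertible_mat_if_transpose_kernel_trivial:
  fixes A :: "'a :: field mat"
  assumes A: "A \<in> carrier_mat n n"
    and ker: "\<And>v. v \<in> carrier_vec n \<Longrightarrow> transpose_mat A *\<^sub>v v = 0\<^sub>v n \<Longrightarrow> v = 0\<^sub>v n"
  shows "invertible_mat A"
proof -
  have "Determinant.det (transpose_mat A) \<noteq> 0"
    using det_0_iff_vec_prod_zero[of "transpose_mat A" n] A ker by auto
  then have "Determinant.det A \<noteq> 0"
    using Determinant.det_transpose[OF A] by simp
  from det_non_zero_imp_unit[OF A this, of "()"]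
  obtain B where "B \<in> carrier_mat n n" "A * B = 1\<^sub>m n" "B * A = 1\<^sub>m n"
    unfolding Units_def by (auto simp: ring_mat_def)
  then show ?thesis
    using A unfolding invertible_mat_def inverts_mat_def by auto
qed

text \<open>Since \<open>r = x ^ n\<close>, each wrapped entry \<open>r * a l\<close> contributes a
  power of \<open>x\<close> shifted by \<open>n\<close>, so every row carries all of
  \<open>a\<close>: the vector of powers of \<open>x\<close> is an eigenvector with eigenvalue
  \<open>f(x)\<close>.\<close>

lemma r_circulant_row_sum:
  assumes x: "x ^ n = r" and i: "i < n"
  shows "(\<Sum>j<n. r_circulant n r a $$ (i, j) * x ^ j) = x ^ i * (\<Sum>l<n. a l * x ^ l)"
proof -
  have shift: "(\<Sum>j<i. h (n + j - i)) = (\<Sum>l\<in>{n-i..<n}. h l)" for h :: "nat \<Rightarrow> complex"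
    by (rule sum.reindex_bij_witness[where i="\<lambda>l. l + i - n" and j="\<lambda>j. n + j - i"])
       (use i in auto)
  have shift': "(\<Sum>j\<in>{i..<n}. h (j - i)) = (\<Sum>l<n-i. h l)" for h :: "nat \<Rightarrow> complex"
    by (rule sum.reindex_bij_witness[where i="\<lambda>l. l + i" and j="\<lambda>j. j - i"])
       (use i in auto)
  have "(\<Sum>j<n. r_circulant n r a $$ (i, j) * x ^ j)
      = (\<Sum>j<n. (if i \<le> j then a (j - i) else r * a (n + j - i)) * x ^ j)"
    using i by (intro sum.cong) (auto simp: r_circulant_def)
  also have "\<dots> = (\<Sum>j<i. (if i \<le> j then a (j - i) else r * a (n + j - i)) * x ^ j)
      + (\<Sum>j\<in>{i..<n}. (if i \<le> j then a (j - i) else r * a (n + j - i)) * x ^ j)"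
    by (subst sum.union_disjoint[symmetric]) (use i in \<open>auto intro!: sum.cong\<close>)
  also have "(\<Sum>j<i. (if i \<le> j then a (j - i) else r * a (n + j - i)) * x ^ j)
      = (\<Sum>j<i. x ^ i * (a (n + j - i) * x ^ (n + j - i)))"
  proof (rule sum.cong)
    fix j assume "j \<in> {..<i}"
    have "r * x ^ j = x ^ (n + j)"
      using x by (simp add: power_add)
    also have "\<dots> = x ^ i * x ^ (n + j - i)"
      using i by (simp flip: power_add)
    finally have "r * x ^ j = x ^ i * x ^ (n + j - i)" .
    with \<open>j \<in> {..<i}\<close> show "(if i \<le> j then a (j - i) else r * a (n + j - i)) * x ^ j
        = x ^ i * (a (n + j - i) * x ^ (n + j - i))"
      by simp
  qed simp
  also have "\<dots> = x ^ i * (\<Sum>l\<in>{n-i..<n}. a l * x ^ l)"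
    by (simp add: sum_distrib_left shift[of "\<lambda>l. x ^ i * (a l * x ^ l)"])
  also have "(\<Sum>j\<in>{i..<n}. (if i \<le> j then a (j - i) else r * a (n + j - i)) * x ^ j)
      = (\<Sum>j\<in>{i..<n}. x ^ i * (a (j - i) * x ^ (j - i)))"
    by (intro sum.cong) (auto simp flip: power_add)
  also have "\<dots> = x ^ i * (\<Sum>l<n-i. a l * x ^ l)"
    by (simp add: sum_distrib_left shift'[of "\<lambda>l. x ^ i * (a l * x ^ l)"])
  also have "x ^ i * (\<Sum>l\<in>{n-i..<n}. a l * x ^ l) + x ^ i * (\<Sum>l<n-i. a l * x ^ l)
      = x ^ i * (\<Sum>l\<in>{..<n-i} \<union> {n-i..<n}. a l * x ^ l)"
    by (subst sum.union_disjoint) (auto simp: algebra_simps)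
  also have "{..<n-i} \<union> {n-i..<n} = {..<n}"
    by auto
  finally show ?thesis .
qed

text \<open>A left kernel vector \<open>v\<close>, paired with these eigenvectors, gives a
  polynomial of degree below \<open>n\<close> that vanishes at all \<open>n\<close> distinct
  \<open>n\<close>-th roots of \<open>r\<close>; hence \<open>v\<close> is zero.\<close>

lemma invertible_mat_r_circulant:
  assumes n: "n > 0" and r: "r \<noteq> 0"
    and nz: "\<And>x. x ^ n = r \<Longrightarrow> (\<Sum>l<n. a l * x ^ l) \<noteq> 0"
  shows "invertible_mat (r_circulant n r a)" (is "invertible_mat ?C")
proof (rule invertible_mat_if_transpose_kernel_trivial[of _ n])
  show C: "?C \<in> carrier_mat n n"
    by (simp add: r_circulant_def)
  fix v assume v: "v \<in> carrier_vec n" and ker: "transpose_mat ?C *\<^sub>v v = 0\<^sub>v n"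
  have col: "(\<Sum>i<n. ?C $$ (i, j) * vec_index v i) = 0" if "j < n" for j
  proof -
    have "vec_index (transpose_mat ?C *\<^sub>v v) j = 0"
      using ker that by simp
    then show ?thesis
      using that v C by (simp add: scalar_prod_def lessThan_atLeast0)
  qed
  have zero: "(\<Sum>i<n. vec_index v i * x ^ i) = 0" if x: "x ^ n = r" for x
  proof -
    have "0 = (\<Sum>j<n. (\<Sum>i<n. ?C $$ (i, j) * vec_index v i) * x ^ j)"
      using col by simp
    also have "\<dots> = (\<Sum>i<n. \<Sum>j<n. vec_index v i * (?C $$ (i, j) * x ^ j))"
      by (subst sum.swap) (simp add: sum_distrib_left sum_distrib_right mult_ac)
    also have "\<dots> = (\<Sum>i<n. vec_index v i * (x ^ i * (\<Sum>l<n. a l * x ^ l)))"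
      by (intro sum.cong) (simp_all add: r_circulant_row_sum[OF x] flip: sum_distrib_left)
    also have "\<dots> = (\<Sum>i<n. vec_index v i * x ^ i) * (\<Sum>l<n. a l * x ^ l)"
      by (simp add: sum_distrib_right mult.assoc)
    finally show ?thesis
      using nz[OF x] by simp
  qed
  have "vec_index v i = 0" if "i < n" for i
  proof (rule ccontr)
    assume "vec_index v i \<noteq> 0"
    then have "\<exists>l\<le>n-1. vec_index v l \<noteq> 0"
      using that by (intro exI[of _ i]) auto
    then have *: "finite {z. (\<Sum>i\<le>n-1. vec_index v i * z ^ i) = 0}"
        "card {z. (\<Sum>i\<le>n-1. vec_index v i * z ^ i) = 0} \<le> n - 1"
      using Poly_Roots.polyfun_rootbound by blast+
    have "{..n-1} = {..<n}"
      using n by auto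
    then have "card {z::complex. z ^ n = r} \<le> n - 1"
      using card_mono[OF *(1), of "{z. z ^ n = r}"] *(2) zero by force
    then show False
      using card_nth_roots[OF r n] n by simp
  qed
  then show "v = 0\<^sub>v n"
    using v by (intro eq_vecI) auto
qed

section \<open>Pell-Tribonacci numbers\<close>

lemma pell_tribonacci_pos: "k \<ge> 1 \<Longrightarrow> pell_tribonacci k (Suc n) > 0"
  by (induction k "Suc n" arbitrary: n rule: pell_tribonacci.induct) auto

lemma pell_tribonacci_Suc_ge:
  "2 * k * pell_tribonacci k (Suc n) + k * pell_tribonacci k n \<le> pell_tribonacci k (Suc (Suc n))"
  by (cases n) auto

lemma pell_tribonacci_mono: "k \<ge> 1 \<Longrightarrow> pell_tribonacci k n \<le> pell_tribonacci k (Suc n)"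
proof (cases n)
  case (Suc m)
  assume "k \<ge> 1"
  then have "1 * pell_tribonacci k n \<le> 2 * k * pell_tribonacci k n"
    by (intro mult_right_mono) auto
  then show ?thesis
    using pell_tribonacci_Suc_ge[of k m] unfolding Suc by linarith
qed simp

text \<open>The left factor is the reciprocal polynomial of the characteristic polynomial. By the
  recurrence all coefficients of the product cancel except the initial \<open>x\<close> and the
  three at the truncation.\<close>

lemma pell_tribonacci_partial_sum:
  fixes x :: "'a :: comm_ring_1"
  shows "(1 - 2 * of_nat k * x - of_nat k * x ^ 2 - x ^ 3)
      * (\<Sum>i<Suc (Suc m). of_nat (pell_tribonacci k i) * x ^ i)
    = x - x ^ Suc (Suc m) * (of_nat (pell_tribonacci k (Suc (Suc m)))
      + of_nat (k * pell_tribonacci k (Suc m) + pell_tribonacci k m) * x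
      + of_nat (pell_tribonacci k (Suc m)) * x ^ 2)"
proof (induction m)
  case 0
  show ?case by (simp add: numeral_2_eq_2 power3_eq_cube algebra_simps)
next
  case (Suc m)
  \<comment> \<open>With \<open>y\<close> for \<open>x ^ m\<close> and \<open>q\<close>,
    \<open>p\<close>, \<open>u\<close> for three consecutive terms, the induction step is a pure
    ring identity.\<close>
  have step: "(1 - 2 * k * x - k * x ^ 2 - x ^ 3) * (S + u * (x * (x * y)))
      = x - x * (x * (x * y)) * ((2 * k * u + k * p + q) + (k * u + p) * x + u * x ^ 2)"
    if "(1 - 2 * k * x - k * x ^ 2 - x ^ 3) * S
      = x - x * (x * y) * (u + (k * p + q) * x + p * x ^ 2)" for k S y u p q :: 'a
    unfolding distrib_left that by (simp add: algebra_simps power2_eq_square power3_eq_cube)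
  show ?case
    using step[of "of_nat k" _ "x ^ m"] Suc
    unfolding sum.lessThan_Suc[of _ "Suc (Suc m)"] pell_tribonacci.simps power_Suc
      of_nat_add of_nat_mult of_nat_numeral by blast
qed

section \<open>Signs at negative arguments\<close>

lemma alternating_sum_neg:
  fixes a :: "nat \<Rightarrow> real"
  assumes "a 0 = 0" "a 1 > 0" and "m > 0"
    and pairs: "(\<forall>i. a (2 * i + 2) \<le> a (2 * i + 1) \<and> a (2 * i + 1) > 0)
      \<or> (\<forall>i. a (2 * i) \<le> a (2 * i + 1))"
  shows "(\<Sum>i<2*m. (- 1) ^ i * a i) < 0"
proof -
  obtain l where m: "m = Suc l"
    using \<open>m > 0\<close> by (cases m) auto
  show ?thesis
    using pairs
  proof
    assume A: "\<forall>i. a (2 * i + 2) \<le> a (2 * i + 1) \<and> a (2 * i + 1) > 0"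
    \<comment> \<open>Pairing starts at index 1, which leaves the last odd term unpaired; this term
      makes the sum strictly negative.\<close>
    have "(\<Sum>i<2*Suc l. (- 1) ^ i * a i) \<le> - a (2 * l + 1)" for l
    proof (induction l)
      case 0
      then show ?case using assms by (simp add: numeral_2_eq_2)
    next
      case (Suc l)
      have "a (2 * l + 2) \<le> a (2 * l + 1)" using A by blast
      then show ?case using Suc by simp
    qed
    from this[of l] show ?thesis
      using A unfolding m by (meson neg_less_0_iff_less order_le_less_trans)
  next
    assume A: "\<forall>i. a (2 * i) \<le> a (2 * i + 1)"
    have "(\<Sum>i<2*Suc l. (- 1) ^ i * a i) < 0" for l
    proof (induction l)
      case 0
      then show ?case using assms by (simp add: numeral_2_eq_2)
    next
      case (Suc l)
      have "a (2 * Suc l) \<le> a (2 * Suc l + 1)" using A by blast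
      then show ?case using Suc by simp
    qed
    then show ?thesis
      unfolding m .
  qed
qed

text \<open>The ratio bound \<open>e (Suc i) \<ge> s / 2 * e i\<close> reproduces itself:
  \<open>p\<close> is at most \<open>s ^ 2 / 4\<close>, so the subtracted term is at most half of
  \<open>s * e (Suc i)\<close>.\<close>

lemma linear_recurrence_pos:
  fixes e :: "nat \<Rightarrow> real"
  assumes rec: "\<And>i. e (Suc (Suc i)) = s * e (Suc i) - p * e i"
    and "s > 0" "4 * p \<le> s ^ 2" "e 0 > 0" "e 1 \<ge> s / 2 * e 0"
  shows "e i > 0"
proof -
  have "e i > 0 \<and> e (Suc i) \<ge> s / 2 * e i"
  proof (induction i)
    case 0
    then show ?case using assms by simp
  next
    case (Suc i)
    then have pos: "e (Suc i) > 0"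
      using \<open>s > 0\<close> by (smt (verit) half_gt_zero mult_pos_pos)
    have "p * e i \<le> s ^ 2 / 4 * e i"
      using Suc assms by (intro mult_right_mono) auto
    also have "\<dots> = s / 2 * (s / 2 * e i)"
      by (simp add: power2_eq_square)
    also have "\<dots> \<le> s / 2 * e (Suc i)"
      using Suc assms by (intro mult_left_mono) auto
    finally show ?case
      using pos by (simp add: rec)
  qed
  then show ?thesis ..
qed

text \<open>
  The sequence \<open>P\<^sub>i\<^sub>+\<^sub>1 - \<alpha> P\<^sub>i\<close> satisfies the second order recurrence belonging to the other two
  roots of the characteristic polynomial; for \<open>k \<ge> 9\<close> these are real and negative.
\<close>

lemma pell_tribonacci_ratio_alternates:
  assumes k: "k \<ge> 9" and \<alpha>: "\<alpha> > 0" "poly (pell_tribonacci_char_poly k) \<alpha> = 0"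
  shows "(- 1) ^ i * (real (pell_tribonacci k (Suc i)) - \<alpha> * real (pell_tribonacci k i)) > 0"
proof -
  \<comment> \<open>The three roots sum to \<open>2 * k\<close> and have product 1, so the other two
    have sum \<open>- s\<close> and product \<open>inverse \<alpha>\<close>.\<close>
  define s where "s = \<alpha> - 2 * real k"
  have s\<alpha>: "s * \<alpha> = real k + inverse \<alpha>"
    using \<alpha> unfolding s_def poly_pell_tribonacci_char_poly
    by (simp add: field_simps power2_eq_square power3_eq_cube)
  then have s\<alpha>_gt: "s * \<alpha> > real k"
    using \<alpha> by simp
  then have s: "s > 0"
    using \<alpha> by (smt (verit) mult_nonpos_nonneg of_nat_0_le_iff)
  have \<alpha>_gt: "\<alpha> > 18"
    using s k unfolding s_def by simp
  then have inv: "inverse \<alpha> < 1 / 4"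
    by (simp add: field_simps)
  have "s \<le> 1 / 2"
  proof (rule ccontr)
    assume "\<not> s \<le> 1 / 2"
    moreover from this have "\<alpha> / 2 \<le> s * \<alpha>"
      using \<alpha> mult_right_mono[of "1 / 2" s \<alpha>] by simp
    ultimately show False
      using s\<alpha> inv unfolding s_def by linarith
  qed
  \<comment> \<open>The discriminant condition amounts to
    \<open>4 * \<alpha> \<le> (s * \<alpha>) ^ 2\<close>. As \<open>s * \<alpha>\<close> exceeds
    \<open>k\<close>, the bound \<open>9 * k \<le> k * k\<close> suffices, whence the threshold
    9.\<close>
  then have "4 * \<alpha> \<le> 8 * real k + 2"
    unfolding s_def by simp
  also have "\<dots> \<le> 9 * real k"
    using k by simp
  also have "\<dots> \<le> real k * real k"
    using k by (intro mult_right_mono) auto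
  also have "\<dots> \<le> (s * \<alpha>) * (s * \<alpha>)"
    using s\<alpha>_gt by (intro mult_mono) auto
  finally have disc: "4 * inverse \<alpha> \<le> s ^ 2"
    using \<alpha> by (simp add: field_simps power2_eq_square)
  \<comment> \<open>The sign factor negates both remaining roots, making them positive; the initial
    values become 1 and \<open>s\<close>.\<close>
  let ?e = "\<lambda>i. (- 1) ^ i * (real (pell_tribonacci k (Suc i)) - \<alpha> * real (pell_tribonacci k i))"
  have "?e (Suc (Suc j)) = s * ?e (Suc j) - inverse \<alpha> * ?e j" for j
  proof -
    have "real k = s * \<alpha> - inverse \<alpha>" "2 * real k = \<alpha> - s"
      using s\<alpha> by (simp_all add: s_def)
    then have "real (pell_tribonacci k (Suc (Suc (Suc j)))) =
        (\<alpha> - s) * real (pell_tribonacci k (Suc (Suc j)))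
        + (s * \<alpha> - inverse \<alpha>) * real (pell_tribonacci k (Suc j)) + real (pell_tribonacci k j)"
      by simp
    then have "real (pell_tribonacci k (Suc (Suc (Suc j)))) - \<alpha> * real (pell_tribonacci k (Suc (Suc j)))
        = - s * (real (pell_tribonacci k (Suc (Suc j))) - \<alpha> * real (pell_tribonacci k (Suc j)))
          - inverse \<alpha> * (real (pell_tribonacci k (Suc j)) - \<alpha> * real (pell_tribonacci k j))"
      using \<alpha> by (simp add: right_diff_distrib del: pell_tribonacci.simps)
        (simp add: algebra_simps del: pell_tribonacci.simps)
    then show ?thesis
      by (simp add: right_diff_distrib del: pell_tribonacci.simps)
  qed
  then show ?thesis
    by (rule linear_recurrence_pos[where e = ?e]) (use s disc in \<open>auto simp: s_def numeral_2_eq_2\<close>)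
qed

lemma pell_tribonacci_sum_neg_large:
  assumes k: "k \<ge> 9" and m: "m > 0" and t: "t > (0 :: real)"
  shows "(\<Sum>i<2*m. real (pell_tribonacci k i) * (- t) ^ i) < 0"
proof -
  obtain \<alpha> where \<alpha>: "\<alpha> > 0" "poly (pell_tribonacci_char_poly k) \<alpha> = 0"
    using ex1_pos_root_pell_tribonacci_char_poly[of k] by blast
  note alt = pell_tribonacci_ratio_alternates[OF k \<alpha>]
  define a where "a i = real (pell_tribonacci k i) * t ^ i" for i
  have pos: "a (Suc i) > 0" for i
    using pell_tribonacci_pos[of k i] k t by (simp add: a_def)
  have "a (2 * i + 2) \<le> a (2 * i + 1)" if "\<alpha> * t \<le> 1" for i
  proof -
    have "real (pell_tribonacci k (2 * i + 2)) \<le> \<alpha> * real (pell_tribonacci k (2 * i + 1))"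
      using alt[of "2 * i + 1"] by simp
    then have "a (2 * i + 2) \<le> \<alpha> * real (pell_tribonacci k (2 * i + 1)) * t ^ (2 * i + 2)"
      unfolding a_def using t by (intro mult_right_mono) auto
    also have "\<dots> = (\<alpha> * t) * a (2 * i + 1)"
      by (simp add: a_def)
    also have "\<dots> \<le> 1 * a (2 * i + 1)"
      using that pos[of "2 * i"] by (intro mult_right_mono) auto
    finally show ?thesis by simp
  qed
  moreover have "a (2 * i) \<le> a (2 * i + 1)" if "\<alpha> * t \<ge> 1" for i
  proof -
    have "1 * a (2 * i) \<le> (\<alpha> * t) * a (2 * i)"
      using that t by (intro mult_right_mono) (auto simp: a_def)
    also have "\<dots> = \<alpha> * real (pell_tribonacci k (2 * i)) * t ^ (2 * i + 1)"
      by (simp add: a_def)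
    also have "\<dots> \<le> a (2 * i + 1)"
      unfolding a_def using alt[of "2 * i"] t by (intro mult_right_mono) auto
    finally show ?thesis by simp
  qed
  ultimately have "(\<forall>i. a (2 * i + 2) \<le> a (2 * i + 1) \<and> a (2 * i + 1) > 0)
      \<or> (\<forall>i. a (2 * i) \<le> a (2 * i + 1))"
    using pos by (cases "\<alpha> * t \<le> 1") auto
  then have "(\<Sum>i<2*m. (- 1) ^ i * a i) < 0"
    using pos[of 0] m t by (intro alternating_sum_neg) (auto simp: a_def)
  then show ?thesis
    by (simp add: a_def power_minus[of t] mult_ac)
qed

text \<open>At a zero, \<open>- t\<close> would equal an even power times a quadratic. For
  \<open>k \<le> 8\<close> the term \<open>k^2 p^2\<close> of its discriminant is at most
  \<open>8 k p^2\<close>, so the discriminant is not positive and the right side is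
  nonnegative.\<close>

lemma pell_tribonacci_sum_nonzero_small:
  fixes t :: real
  assumes k: "k \<ge> 1" "k \<le> 8" and m: "m > 0" and t: "t > 0"
  shows "(\<Sum>i<2*m. real (pell_tribonacci k i) * (- t) ^ i) \<noteq> 0"
proof
  assume zero: "(\<Sum>i<2*m. real (pell_tribonacci k i) * (- t) ^ i) = 0"
  define n where "n = 2 * (m - 1)"
  have n: "2 * m = Suc (Suc n)"
    using m by (simp add: n_def)
  define p q u where "p = real (pell_tribonacci k (Suc n))" and "q = real (pell_tribonacci k n)"
    and "u = real (pell_tribonacci k (Suc (Suc n)))"
  have p: "p > 0" and q: "0 \<le> q" "q \<le> p"
    using pell_tribonacci_pos[of k n] pell_tribonacci_mono[of k n] k
    unfolding p_def q_def by simp_all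
  have u: "u \<ge> 2 * real k * p + real k * q"
    using of_nat_mono[OF pell_tribonacci_Suc_ge[of k n], where 'a = real]
    unfolding p_def q_def u_def of_nat_add of_nat_mult of_nat_numeral .
  have quad: "- t = (- t) ^ Suc (Suc n) * (u + (real k * p + q) * (- t) + p * (- t) ^ 2)"
    using pell_tribonacci_partial_sum[of k "- t" n] zero
    unfolding n p_def q_def u_def by simp
  have "(real k * p + q) ^ 2 \<le> 4 * p * u"
  proof -
    have "real k * (real k * (p * p)) \<le> 8 * (real k * (p * p))"
      using k p by (intro mult_right_mono) auto
    moreover have "q * q \<le> p * q"
      using q by (intro mult_right_mono) auto
    moreover have "1 * (p * q) \<le> real k * (p * q)"
      using k p q by (intro mult_right_mono) auto
    moreover have "0 \<le> real k * (p * q)"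
      using p q by simp
    moreover have "4 * p * (2 * real k * p + real k * q) \<le> 4 * p * u"
      using u p by (intro mult_left_mono) auto
    ultimately show ?thesis
      by (simp add: power2_eq_square algebra_simps)
  qed
  moreover have "4 * p * (u + (real k * p + q) * (- t) + p * (- t) ^ 2)
      = (2 * p * t - (real k * p + q)) ^ 2 + (4 * p * u - (real k * p + q) ^ 2)"
    by (simp add: power2_eq_square algebra_simps)
  ultimately have "0 \<le> 4 * p * (u + (real k * p + q) * (- t) + p * (- t) ^ 2)"
    by (smt (verit) zero_le_power2)
  then have "0 \<le> u + (real k * p + q) * (- t) + p * (- t) ^ 2"
    using p by (simp add: zero_le_mult_iff)
  moreover have "(- t) ^ Suc (Suc n) \<ge> 0"
    by (metis n even_mult_iff even_numeral zero_le_even_power)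
  ultimately show False
    using quad t by (smt (verit) mult_nonneg_nonneg)
qed

lemma pell_tribonacci_sum_nonzero_real:
  fixes x :: real
  assumes k: "k \<ge> 1" and n: "n \<ge> 2" and x: "x ^ n > 0"
  shows "(\<Sum>i<n. real (pell_tribonacci k i) * x ^ i) \<noteq> 0"
proof (cases "x > 0")
  case True
  \<comment> \<open>The term at index 0 vanishes, so index 1 supplies the strictly positive
    term.\<close>
  have "0 < (\<Sum>i<n. real (pell_tribonacci k i) * x ^ i)"
    by (rule sum_pos2[where i = 1]) (use n True in auto)
  then show ?thesis by simp
next
  case False
  then have "x < 0"
    using x n by (cases "x = 0") (auto simp: power_0_left split: if_splits)
  then have "even n"
    using x by (metis less_asym power_less_zero_eq)
  then obtain m where m: "n = 2 * m" by (elim evenE)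
  show ?thesis
    using pell_tribonacci_sum_neg_large[of k m "- x"] pell_tribonacci_sum_nonzero_small[of k m "- x"]
      k n m \<open>x < 0\<close> by (cases "k \<le> 8") auto
qed

section \<open>Non-real zeros\<close>

text \<open>The conjugate of \<open>x\<close> is the other root, so the product of the roots is the
  squared modulus.\<close>

lemma real_quadratic_nonreal_root_norm:
  fixes a b c :: real and x :: complex
  assumes root: "of_real a * x ^ 2 + of_real b * x + of_real c = 0" and "Im x \<noteq> 0"
  shows "a * (cmod x) ^ 2 = c"
proof -
  have "Im (of_real a * x ^ 2 + of_real b * x + of_real c) = 0"
    and re: "Re (of_real a * x ^ 2 + of_real b * x + of_real c) = 0"
    using root by simp_all
  then have "Im x * (2 * a * Re x + b) = 0"
    by (simp add: power2_eq_square algebra_simps)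
  then have b: "b = - 2 * a * Re x"
    using \<open>Im x \<noteq> 0\<close> by simp
  show ?thesis
    using re unfolding cmod_power2 b by (simp add: power2_eq_square algebra_simps)
qed

theorem theorem5:
  fixes k n :: nat and \<alpha> r :: real
  assumes "k \<ge> 1" and "n \<ge> 2"
    and "\<alpha> > 0" and "poly (pell_tribonacci_char_poly k) \<alpha> = 0"
    and "r > 0"
    and "r \<noteq> inverse \<alpha>"
    and "r \<noteq> real (pell_tribonacci k (n - 1)) powr (- (real n / 2))
           * real (pell_tribonacci k n) powr (real n / 2)"
  shows "invertible_mat (pell_tribonacci_circulant k n (complex_of_real r))"
  unfolding pell_tribonacci_circulant_def
proof (rule invertible_mat_r_circulant)
  fix x :: complex
  assume x: "x ^ n = complex_of_real r"
  show "(\<Sum>l<n. of_nat (pell_tribonacci k l) * x ^ l) \<noteq> 0"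
  proof
    assume zero: "(\<Sum>l<n. of_nat (pell_tribonacci k l) * x ^ l) = 0"
    show False
    proof (cases "Im x = 0")
      case True
      define y where "y = Re x"
      have xy: "x = of_real y"
        using True by (simp add: y_def complex_eq_iff)
      have "y ^ n = r"
        using x unfolding xy by (simp flip: of_real_power)
      moreover have "of_real (\<Sum>l<n. real (pell_tribonacci k l) * y ^ l) = (0 :: complex)"
        using zero unfolding xy by simp
      ultimately show False
        using pell_tribonacci_sum_nonzero_real[of k n y] assms by (simp only: of_real_eq_0_iff)
    next
      case False
      define m where "m = n - 2"
      have n: "n = Suc (Suc m)"
        using \<open>n \<ge> 2\<close> by (simp add: m_def)
      define p q u where "p = real (pell_tribonacci k (Suc m))" and "q = real (pell_tribonacci k m)"
        and "u = real (pell_tribonacci k (Suc (Suc m)))"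
      have pu: "p > 0" "u > 0"
        using pell_tribonacci_pos \<open>k \<ge> 1\<close> by (simp_all add: p_def u_def del: pell_tribonacci.simps)
      have "x = of_real r * (of_real u + of_real (real k * p + q) * x + of_real p * x ^ 2)"
        using pell_tribonacci_partial_sum[of k x m] zero x
        unfolding n p_def q_def u_def by simp
      \<comment> \<open>Both the leading and the constant coefficient carry the factor
        \<open>r\<close>, so the product of the roots is \<open>u / p\<close>, independent of
        \<open>r\<close>.\<close>
      then have "of_real (r * p) * x ^ 2 + of_real (r * (real k * p + q) - 1) * x + of_real (r * u) = 0"
        by (simp add: algebra_simps)
      then have "r * p * cmod x ^ 2 = r * u"
        using False by (rule real_quadratic_nonreal_root_norm)
      then have norm: "cmod x ^ 2 = u / p"
        using pu \<open>r > 0\<close> by (simp add: field_simps)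
      have "cmod x > 0"
        using False by auto
      have "r = cmod x ^ n"
        using x \<open>r > 0\<close> by (metis abs_of_pos norm_of_real norm_power)
      also have "\<dots> = (cmod x ^ 2) powr (real n / 2)"
        using \<open>cmod x > 0\<close> by (simp add: powr_powr flip: powr_realpow powr_numeral)
      also have "\<dots> = p powr (- (real n / 2)) * u powr (real n / 2)"
        unfolding norm using pu by (simp add: powr_divide powr_minus divide_simps)
      finally show False
        using assms(7) unfolding n p_def u_def by (simp del: pell_tribonacci.simps)
    qed
  qed
qed (use assms in auto)

end
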